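(* The problem $$\mathcal{P}^{\sqsubset}:\ \min\ \mathbf{c}^t\mathbf{x}\ \text{ s.t. } A_1\mathbf{x}\le\mathbf{b}_1,\ \ \sum_{j=1}^n a^{(2)}_{ij}x_j+\sum_{j=1}^n(\lambda d_{ij})^{\uparrow}x_j\le b_{2,i}\ \ \forall i\in\{1,\dots,m_2\},\ \ \mathbf{x}\in\mathbb{R}^{n_c}_+\times\mathbb{Z}^{n_i}_+$$ is a restriction of $\mathcal{P}^{\ge0}(\lambda)$ for all $\lambda\in[\lambda_1,\lambda_2]$ (every feasible solution of the former is feasible for the latter); hence its optimal value is an upper bound on the optimal value of $\mathcal{P}^{\ge0}(\lambda)$ for all $\lambda\in[\lambda_1,\lambda_2]$. Similarly, the problem $$\mathcal{P}^{\sqsupset}:\ \min\ \mathbf{c}^t\mathbf{x}\ \text{ s.t. } A_1\mathbf{x}\le\mathbf{b}_1,\ \ \sum_{j=1}^n a^{(2)}_{ij}x_j+\sum_{j=1}^n(\lambda d_{ij})^{\downarrow}x_j\le b_{2,i}\ \ \forall i\in\{1,\dots,m_2\},\ \ \mathbf{x}\in\mathbb{R}^{n_c}_+\times\mathbb{Z}^{n_i}_+$$ is a relaxation of $\mathcal{P}^{\ge0}(\lambda)$ for all $\lambda\in[\lambda_1,\lambda_2]$ (every feasible solution of the latter is feasible for the former); hence its optimal value is a lower bound on the optimal value of $\mathcal{P}^{\ge0}(\lambda)$ for all $\lambda\in[\lambda_1,\lambda_2]$.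
   Context: Let $n=n_c+n_i$, $\mathbf{c}\in\mathbb{R}^n$, $A_1\in\mathbb{R}^{m_1\times n}$, $A_2=(a^{(2)}_{ij}),\ D=(d_{ij})\in\mathbb{R}^{m_2\times n}$, $\mathbf{b}_1\in\mathbb{R}^{m_1}$, $\mathbf{b}_2=(b_{2,i})\in\mathbb{R}^{m_2}$, and real numbers $\lambda_1\le\lambda_2$. For $\lambda\in\mathbb{R}$, $$\mathcal{P}^{\ge0}(\lambda):\ \min\ \mathbf{c}^t\mathbf{x}\ \text{ s.t. } A_1\mathbf{x}\le\mathbf{b}_1,\ A_2\mathbf{x}+\lambda D\mathbf{x}\le\mathbf{b}_2,\ \mathbf{x}\in\mathbb{R}^{n_c}_+\times\mathbb{Z}^{n_i}_+ ,$$ with all variables nonnegative. For $a\in\mathbb{R}$ and the fixed interval $[\lambda_1,\lambda_2]$, $(a\lambda)^{\uparrow}=\max_{\lambda\in[\lambda_1,\lambda_2]}a\lambda$ and $(a\lambda)^{\downarrow}=\min_{\lambda\in[\lambda_1,\lambda_2]}a\lambda$; these are constants not depending on $\lambda$. Optimal values are infima in $\mathbb{R}\cup\{\pm\infty\}$, equal to $+\infty$ for infeasible problems. *)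

theory Defs
  imports "Jordan_Normal_Form.Matrix" "HOL-Library.Extended_Real"
begin

(* A zero number of variables of either kind, or of rows, is allowed throughout;
   variables j < nc are continuous, variables nc \<le> j < nc + ni are integer. *)
definition mixed_orthant :: "nat \<Rightarrow> nat \<Rightarrow> real vec set" where
  "mixed_orthant nc ni =
     {x \<in> carrier_vec (nc + ni).
        (\<forall>j < nc + ni. 0 \<le> x $ j) \<and> (\<forall>j \<in> {nc..<nc + ni}. x $ j \<in> \<int>)}"

definition lin_max :: "real \<Rightarrow> real \<Rightarrow> real \<Rightarrow> real" where
  "lin_max l1 l2 a = (GREATEST y. y \<in> (\<lambda>l. a * l) ` {l1..l2})"

definition lin_min :: "real \<Rightarrow> real \<Rightarrow> real \<Rightarrow> real" where
  "lin_min l1 l2 a = (LEAST y. y \<in> (\<lambda>l. a * l) ` {l1..l2})"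

(* The extrema exist on a nonempty interval, so neither description is vacuous. *)
lemma lin_max_eq:
  assumes "l1 \<le> l2"
  shows "lin_max l1 l2 a = max (a * l1) (a * l2)"
  unfolding lin_max_def
proof (rule Greatest_equality)
  show "max (a * l1) (a * l2) \<in> (\<lambda>l. a * l) ` {l1..l2}"
    using assms by (auto simp: max_def)
  show "y \<le> max (a * l1) (a * l2)" if "y \<in> (\<lambda>l. a * l) ` {l1..l2}" for y
    using that by (cases "a \<ge> 0") (auto simp: le_max_iff_disj mult_left_mono mult_left_mono_neg)
qed

lemma lin_min_eq:
  assumes "l1 \<le> l2"
  shows "lin_min l1 l2 a = min (a * l1) (a * l2)"
  unfolding lin_min_def
proof (rule Least_equality)
  show "min (a * l1) (a * l2) \<in> (\<lambda>l. a * l) ` {l1..l2}"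
    using assms by (auto simp: min_def)
  show "min (a * l1) (a * l2) \<le> y" if "y \<in> (\<lambda>l. a * l) ` {l1..l2}" for y
    using that by (cases "a \<ge> 0") (auto simp: min_le_iff_disj mult_left_mono mult_left_mono_neg)
qed

definition feasible_param ::
  "nat \<Rightarrow> nat \<Rightarrow> real mat \<Rightarrow> real vec \<Rightarrow> real mat \<Rightarrow> real mat \<Rightarrow> real vec \<Rightarrow> real \<Rightarrow> real vec set" where
  "feasible_param nc ni A1 b1 A2 D b2 l =
     {x \<in> mixed_orthant nc ni.
        A1 *\<^sub>v x \<le> b1 \<and> A2 *\<^sub>v x + l \<cdot>\<^sub>v (D *\<^sub>v x) \<le> b2}"

definition feasible_restr ::
  "nat \<Rightarrow> nat \<Rightarrow> real mat \<Rightarrow> real vec \<Rightarrow> real mat \<Rightarrow> real mat \<Rightarrow> real vec \<Rightarrow> real \<Rightarrow> real \<Rightarrow> real vec set" where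
  "feasible_restr nc ni A1 b1 A2 D b2 l1 l2 =
     {x \<in> mixed_orthant nc ni.
        A1 *\<^sub>v x \<le> b1 \<and>
        (\<forall>i < dim_vec b2.
           (\<Sum>j<nc + ni. A2 $$ (i, j) * x $ j)
           + (\<Sum>j<nc + ni. lin_max l1 l2 (D $$ (i, j)) * x $ j) \<le> b2 $ i)}"

definition feasible_relax ::
  "nat \<Rightarrow> nat \<Rightarrow> real mat \<Rightarrow> real vec \<Rightarrow> real mat \<Rightarrow> real mat \<Rightarrow> real vec \<Rightarrow> real \<Rightarrow> real \<Rightarrow> real vec set" where
  "feasible_relax nc ni A1 b1 A2 D b2 l1 l2 =
     {x \<in> mixed_orthant nc ni.
        A1 *\<^sub>v x \<le> b1 \<and>
        (\<forall>i < dim_vec b2.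
           (\<Sum>j<nc + ni. A2 $$ (i, j) * x $ j)
           + (\<Sum>j<nc + ni. lin_min l1 l2 (D $$ (i, j)) * x $ j) \<le> b2 $ i)}"

(* The infimum in ereal of the empty set is \<infinity>, the value of an infeasible problem. *)
definition opt_value :: "real vec \<Rightarrow> real vec set \<Rightarrow> ereal" where
  "opt_value c F = (INF x \<in> F. ereal (c \<bullet> x))"

end

theory Submission
  imports Defs
begin

text \<open>For fixed \<lambda> in the interval, each coefficient \<open>D $$ (i, j) * l\<close>
  lies between its minimum and its maximum over the interval. Since x \<ge> 0, multiplying by
  \<open>x $ j\<close> and summing keeps these inequalities (\<open>mixed_orthant_sum_mono\<close>),
  so in every row the left-hand side at \<lambda> lies between those of the relaxation and the
  restriction. The bounds \<open>b2\<close> are the same in all three problems, hence the feasible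
  sets are nested, and an infimum can only drop when its set grows
  (\<open>opt_value_antimono\<close>).\<close>

lemma mult_le_lin_max:
  assumes "l \<in> {l1..l2}"
  shows "a * l \<le> lin_max l1 l2 a"
  using assms
  by (cases "a \<ge> 0") (auto simp: lin_max_eq le_max_iff_disj mult_left_mono mult_left_mono_neg)

lemma lin_min_le_mult:
  assumes "l \<in> {l1..l2}"
  shows "lin_min l1 l2 a \<le> a * l"
  using assms
  by (cases "a \<ge> 0") (auto simp: lin_min_eq min_le_iff_disj mult_left_mono mult_left_mono_neg)

lemma opt_value_antimono:
  assumes "F \<subseteq> G"
  shows "opt_value c G \<le> opt_value c F"
  unfolding opt_value_def using assms by (intro INF_superset_mono) auto

text \<open>Puts the matrix constraint into the row-by-row shape of the other two problems, so that
  the three differ only in the coefficients that multiply \<open>x $ j\<close> in the second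
  sum.\<close>

lemma mem_feasible_param_iff:
  assumes "A2 \<in> carrier_mat m2 (nc + ni)" and "D \<in> carrier_mat m2 (nc + ni)"
    and "b2 \<in> carrier_vec m2"
  shows "x \<in> feasible_param nc ni A1 b1 A2 D b2 l \<longleftrightarrow>
    x \<in> mixed_orthant nc ni \<and> A1 *\<^sub>v x \<le> b1 \<and>
    (\<forall>i < dim_vec b2. (\<Sum>j<nc + ni. A2 $$ (i, j) * x $ j)
       + (\<Sum>j<nc + ni. D $$ (i, j) * l * x $ j) \<le> b2 $ i)"
proof (cases "x \<in> mixed_orthant nc ni")
  case True
  \<comment> \<open>\<open>scalar_prod\<close> sums up to the dimension of its second argument, here
    x.\<close>
  then have "dim_vec x = nc + ni"
    by (auto simp: mixed_orthant_def)
  then have "(A2 *\<^sub>v x + l \<cdot>\<^sub>v (D *\<^sub>v x)) $ i =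
      (\<Sum>j<nc + ni. A2 $$ (i, j) * x $ j) + (\<Sum>j<nc + ni. D $$ (i, j) * l * x $ j)"
    if "i < m2" for i
    using that assms
    by (simp add: scalar_prod_def sum_distrib_left lessThan_atLeast0 mult_ac)
  \<comment> \<open>The order on vectors also demands equal dimensions, which the carrier
    assumptions supply.\<close>
  then show ?thesis
    using True assms by (auto simp: feasible_param_def less_eq_vec_def)
qed (simp add: feasible_param_def)

text \<open>The one place where the sign of the variables enters: a negative \<open>x $ j\<close>
  would reverse its summand's inequality.\<close>

lemma mixed_orthant_sum_mono:
  assumes "x \<in> mixed_orthant nc ni" and "\<And>j. j < nc + ni \<Longrightarrow> f j \<le> g j"
  shows "(\<Sum>j<nc + ni. f j * x $ j) \<le> (\<Sum>j<nc + ni. g j * x $ j)"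
  using assms by (intro sum_mono mult_right_mono) (auto simp: mixed_orthant_def)

lemma feasible_restr_subset_param:
  assumes "A2 \<in> carrier_mat m2 (nc + ni)" and "D \<in> carrier_mat m2 (nc + ni)"
    and "b2 \<in> carrier_vec m2" and "l \<in> {l1..l2}"
  shows "feasible_restr nc ni A1 b1 A2 D b2 l1 l2 \<subseteq> feasible_param nc ni A1 b1 A2 D b2 l"
proof
  fix x
  assume x: "x \<in> feasible_restr nc ni A1 b1 A2 D b2 l1 l2"
  then have "(\<Sum>j<nc + ni. D $$ (i, j) * l * x $ j)
      \<le> (\<Sum>j<nc + ni. lin_max l1 l2 (D $$ (i, j)) * x $ j)" for i
    using assms(4) by (intro mixed_orthant_sum_mono mult_le_lin_max) (auto simp: feasible_restr_def)
  with x show "x \<in> feasible_param nc ni A1 b1 A2 D b2 l"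
    unfolding mem_feasible_param_iff[OF assms(1-3)] feasible_restr_def
    \<comment> \<open>Adding the common \<open>A2\<close> sum to both sides and chaining with the
      restricted row gives the row at \<open>l\<close>.\<close>
    by (fastforce intro: order_trans[OF add_left_mono])
qed

lemma feasible_param_subset_relax:
  assumes "A2 \<in> carrier_mat m2 (nc + ni)" and "D \<in> carrier_mat m2 (nc + ni)"
    and "b2 \<in> carrier_vec m2" and "l \<in> {l1..l2}"
  shows "feasible_param nc ni A1 b1 A2 D b2 l \<subseteq> feasible_relax nc ni A1 b1 A2 D b2 l1 l2"
proof
  fix x
  assume x: "x \<in> feasible_param nc ni A1 b1 A2 D b2 l"
  then have "(\<Sum>j<nc + ni. lin_min l1 l2 (D $$ (i, j)) * x $ j)
      \<le> (\<Sum>j<nc + ni. D $$ (i, j) * l * x $ j)" for i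
    using assms(4) by (intro mixed_orthant_sum_mono lin_min_le_mult) (auto simp: feasible_param_def)
  with x show "x \<in> feasible_relax nc ni A1 b1 A2 D b2 l1 l2"
    unfolding mem_feasible_param_iff[OF assms(1-3)] feasible_relax_def
    by (fastforce intro: order_trans[OF add_left_mono])
qed

theorem theorem5:
  fixes nc ni m1 m2 :: nat
    and c b1 b2 :: "real vec"
    and A1 A2 D :: "real mat"
    and l1 l2 :: real
  assumes "c \<in> carrier_vec (nc + ni)"
    and "A1 \<in> carrier_mat m1 (nc + ni)"
    and "A2 \<in> carrier_mat m2 (nc + ni)"
    and "D \<in> carrier_mat m2 (nc + ni)"
    and "b1 \<in> carrier_vec m1"
    and "b2 \<in> carrier_vec m2"
    and "l1 \<le> l2"
  shows "(\<forall>l \<in> {l1..l2}.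
            feasible_restr nc ni A1 b1 A2 D b2 l1 l2 \<subseteq> feasible_param nc ni A1 b1 A2 D b2 l)
       \<and> (\<forall>l \<in> {l1..l2}.
            opt_value c (feasible_param nc ni A1 b1 A2 D b2 l)
              \<le> opt_value c (feasible_restr nc ni A1 b1 A2 D b2 l1 l2))
       \<and> (\<forall>l \<in> {l1..l2}.
            feasible_param nc ni A1 b1 A2 D b2 l \<subseteq> feasible_relax nc ni A1 b1 A2 D b2 l1 l2)
       \<and> (\<forall>l \<in> {l1..l2}.
            opt_value c (feasible_relax nc ni A1 b1 A2 D b2 l1 l2)
              \<le> opt_value c (feasible_param nc ni A1 b1 A2 D b2 l))"
  using feasible_restr_subset_param[OF assms(3,4,6)] feasible_param_subset_relax[OF assms(3,4,6)]
  by (intro conjI ballI opt_value_antimono)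

end
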